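(* For every integer $n \ge 1$, let $M_n = 2^n - 1$ be the $n$-th (non-zero) Mersenne number. Then, with $m = \lceil n/2 \rceil$, $$DS(M_n) = M_n + M_m + 1 = M_n + 2^m,$$ where $DS$ denotes the Dyck successor function.
   Context: A Dyck number is a natural number in whose binary expansion (written without leading zeros) every suffix (final fragment, i.e. block of least significant digits) contains at most as many digits $0$ as digits $1$. By convention $0$ is also a Dyck number (its binary expansion is regarded as empty). In increasing order the Dyck numbers are $0, 1, 3, 5, 7, 11, 13, 15, 19, 21, 23, 27, 29, 31, 39, \dots$ (OEIS A036991). The Mersenne numbers are $M_k = 2^k - 1$ for $k \ge 0$; all of them are Dyck numbers. The Dyck successor function $DS$ sends a Dyck number $d$ to the next one, i.e. $DS(d)$ is the smallest Dyck number strictly greater than $d$. *)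

theory Defs
  imports Complex_Main "HOL-Library.Sublist"
begin

text \<open>Most significant digit first, without leading zeros; the expansion of 0 is empty.\<close>

fun binary_expansion :: "nat \<Rightarrow> nat list" where
  "binary_expansion n = (if n = 0 then [] else binary_expansion (n div 2) @ [n mod 2])"

declare binary_expansion.simps [simp del]

definition dyck_number :: "nat \<Rightarrow> bool" where
  "dyck_number d \<longleftrightarrow>
     (\<forall>s. suffix s (binary_expansion d) \<longrightarrow> count_list s 0 \<le> count_list s 1)"

definition mersenne :: "nat \<Rightarrow> nat" where
  "mersenne k = 2 ^ k - 1"

definition dyck_succ :: "nat \<Rightarrow> nat" where
  "dyck_succ d = (LEAST e. dyck_number e \<and> d < e)"

lemma binary_expansion_mersenne: "binary_expansion (mersenne k) = replicate k 1"
proof (induction k)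
  case 0
  show ?case by (simp add: mersenne_def binary_expansion.simps)
next
  case (Suc k)
  have ge: "(1::nat) \<le> 2 ^ k" by simp
  have M: "mersenne (Suc k) = 2 * mersenne k + 1"
    using ge unfolding mersenne_def power_Suc by linarith
  show ?case
    by (subst binary_expansion.simps) (simp add: M Suc.IH replicate_append_same)
qed

lemma dyck_number_mersenne: "dyck_number (mersenne k)"
  unfolding dyck_number_def
proof (intro allI impI)
  fix s :: "nat list"
  assume "suffix s (binary_expansion (mersenne k))"
  then have "suffix s (replicate k 1)"
    by (simp only: binary_expansion_mersenne)
  then have "set s \<subseteq> set (replicate k (1::nat))" by (rule set_mono_suffix)
  then have "set s \<subseteq> {1}" by (auto simp: set_replicate_conv_if split: if_splits)
  then have "0 \<notin> set s" by auto
  then show "count_list s 0 \<le> count_list s 1"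
    by (simp add: count_list_0_iff)
qed

text \<open>The minimum defining \<^const>\<open>dyck_succ\<close> is therefore always taken over a nonempty set.\<close>

lemma dyck_succ_exists: "\<exists>e. dyck_number e \<and> d < e"
proof (intro exI conjI)
  show "dyck_number (mersenne (Suc d))" by (rule dyck_number_mersenne)
  have "d < 2 ^ d" by (rule less_exp)
  then show "d < mersenne (Suc d)" unfolding mersenne_def power_Suc by linarith
qed

end

theory Submission
  imports Defs
begin

text \<open>
  The number \<open>2^n + r\<close> with \<open>r < 2^n\<close> is written as a leading 1 followed by the \<open>n\<close> digits of
  the zero-padded \<open>r\<close>. For a Dyck number this block of \<open>n\<close> digits must contain at least
  \<open>n / 2\<close> ones, hence at least \<open>m\<close> ones, and the least \<open>r\<close> with \<open>m\<close> ones is \<open>2^m - 1\<close>. That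
  \<open>r\<close> does give a Dyck number, since its digits are \<open>n - m \<le> m\<close> zeros followed by \<open>m\<close> ones.
\<close>

lemma binary_expansion_nonzero:
  "n > 0 \<Longrightarrow> binary_expansion n = binary_expansion (n div 2) @ [n mod 2]"
  by (subst binary_expansion.simps) simp

lemma binary_expansion_0 [simp]: "binary_expansion 0 = []"
  by (simp add: binary_expansion.simps)

text \<open>Induction on \<open>n\<close> peels off the last digit: halving
  \<open>2 ^ Suc n + r\<close> gives \<open>2 ^ n + r div 2\<close>.\<close>

lemma binary_expansion_power_add:
  assumes "r < 2 ^ n"
  shows "binary_expansion (2 ^ n + r) =
    1 # replicate (n - length (binary_expansion r)) 0 @ binary_expansion r"
  using assms
proof (induction n arbitrary: r)
  case 0
  then show ?case by (simp add: binary_expansion_nonzero)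
next
  case (Suc n)
  have "binary_expansion (2 ^ Suc n + r) = binary_expansion (2 ^ n + r div 2) @ [r mod 2]"
    by (subst binary_expansion_nonzero) simp_all
  also have "binary_expansion (2 ^ n + r div 2) =
      1 # replicate (n - length (binary_expansion (r div 2))) 0 @ binary_expansion (r div 2)"
    using Suc.prems by (intro Suc.IH) simp
  \<comment> \<open>For \<open>r > 0\<close> the last digit extends the expansion of
    \<open>r div 2\<close>; for \<open>r = 0\<close>, whose expansion is empty, it is one more
    padding zero.\<close>
  finally show ?case
    by (cases "r = 0") (simp_all add: replicate_append_same binary_expansion_nonzero)
qed

lemma length_binary_expansion:
  "length (binary_expansion n) = count_list (binary_expansion n) 0 + count_list (binary_expansion n) 1"
proof (induction n rule: binary_expansion.induct)
  case (1 n)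
  then show ?case
    by (cases "n = 0"; cases "even n") (simp_all add: binary_expansion_nonzero odd_iff_mod_2_eq_one)
qed

text \<open>Passing from \<open>q = n div 2\<close> to \<open>n\<close>, a final 1 doubles both
  \<open>2 ^ c\<close> and \<open>q + 1\<close>, while a final 0 keeps the count \<open>c\<close> of
  ones and does not decrease the number.\<close>

lemma power_count_ones_le: "2 ^ count_list (binary_expansion n) 1 \<le> n + 1"
proof (induction n rule: binary_expansion.induct)
  case (1 n)
  show ?case
  proof (cases "n = 0")
    case False
    with 1 have "2 ^ count_list (binary_expansion (n div 2)) 1 \<le> n div 2 + 1" by simp
    with False show ?thesis
      by (cases "even n") (auto simp: binary_expansion_nonzero odd_iff_mod_2_eq_one, presburger+)
  qed simp
qed

lemma count_list_replicate: "count_list (replicate k x) y = (if x = y then k else 0)"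
  by (induction k) auto

lemma dyck_number_power_add_mersenne:
  assumes "m \<le> n" "n \<le> 2 * m"
  shows "dyck_number (2 ^ n + mersenne m)"
proof -
  have "(2::nat) ^ m \<le> 2 ^ n" using assms(1) by simp
  then have "mersenne m < 2 ^ n"
    unfolding mersenne_def by (metis diff_less less_le_trans pos2 zero_less_one zero_less_power)
  then have "binary_expansion (2 ^ n + mersenne m) = 1 # replicate (n - m) 0 @ replicate m 1"
    by (simp add: binary_expansion_power_add binary_expansion_mersenne)
  moreover have "count_list s 0 \<le> count_list s 1"
    if s: "suffix s ((1::nat) # replicate (n - m) 0 @ replicate m 1)" for s
  proof -
    \<comment> \<open>A suffix is the whole word, lies within the final ones, or takes all
      \<open>m\<close> ones and at most \<open>n - m \<le> m\<close> zeros.\<close>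
    consider "s = 1 # replicate (n - m) 0 @ replicate m 1"
      | "suffix s (replicate m 1)"
      | t where "s = t @ replicate m 1" "suffix t (replicate (n - m) 0)"
      using s unfolding suffix_Cons suffix_append by blast
    then show ?thesis
    proof cases
      case 1
      then show ?thesis using assms by (simp add: count_list_replicate)
    next
      case 2
      then have "set s \<subseteq> {1}" using set_mono_suffix by fastforce
      then have "count_list s 0 = 0" by (auto simp: count_list_0_iff)
      then show ?thesis by simp
    next
      case 3
      have "count_list t 0 \<le> length t" by (rule count_le_length)
      also have "length t \<le> n - m" using suffix_length_le[OF 3(2)] by simp
      finally show ?thesis using 3(1) assms by (simp add: count_list_replicate)
    qed
  qed
  ultimately show ?thesis by (simp add: dyck_number_def)
qed

lemma dyck_number_power_add_lower_bound:
  assumes "dyck_number (2 ^ n + r)" "r < 2 ^ n" "n + 1 \<ge> 2 * m"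
  shows "2 ^ m \<le> r + 1"
proof -
  let ?b = "binary_expansion r"
  have "count_list (replicate (n - length ?b) 0 @ ?b) 0
      \<le> count_list (replicate (n - length ?b) 0 @ ?b) 1"
    using assms(1) unfolding dyck_number_def binary_expansion_power_add[OF assms(2)]
    by (auto simp: suffix_Cons)
  \<comment> \<open>The padded block has at least \<open>n\<close> digits, so with \<open>c\<close>
    ones in \<open>?b\<close> it has at least \<open>n - c\<close> zeros. Hence
    \<open>n \<le> 2 * c\<close>, so \<open>2 * m \<le> 2 * c + 1\<close>, and integrality gives
    \<open>m \<le> c\<close>.\<close>
  then have "m \<le> count_list ?b 1"
    using assms(3) length_binary_expansion[of r] by (simp add: count_list_replicate)
  then have "(2::nat) ^ m \<le> 2 ^ count_list ?b 1" by simp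
  also have "\<dots> \<le> r + 1" by (rule power_count_ones_le)
  finally show ?thesis .
qed

theorem theorem5:
  fixes n m :: nat
  assumes "n \<ge> 1"
    and "m = nat \<lceil>real n / 2\<rceil>"
  shows "dyck_succ (mersenne n) = mersenne n + mersenne m + 1
       \<and> mersenne n + mersenne m + 1 = mersenne n + 2 ^ m"
proof
  have m: "n \<le> 2 * m" "2 * m \<le> n + 1" "m \<le> n" using assms by linarith+
  have M: "mersenne k + 1 = 2 ^ k" for k by (simp add: mersenne_def)
  have target: "mersenne n + mersenne m + 1 = 2 ^ n + mersenne m"
    using M[of n] by simp
  show "mersenne n + mersenne m + 1 = mersenne n + 2 ^ m" using M[of m] by simp
  show "dyck_succ (mersenne n) = mersenne n + mersenne m + 1"
    unfolding dyck_succ_def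
  proof (rule Least_equality)
    show "dyck_number (mersenne n + mersenne m + 1) \<and> mersenne n < mersenne n + mersenne m + 1"
      using dyck_number_power_add_mersenne[OF m(3,1)] by (simp only: target) (simp add: M flip: target)
  next
    fix e
    assume e: "dyck_number e \<and> mersenne n < e"
    then obtain r where r: "e = 2 ^ n + r"
      using M[of n] by (metis Suc_eq_plus1 Suc_leI le_Suc_ex)
    show "mersenne n + mersenne m + 1 \<le> e"
    proof (cases "r < 2 ^ n")
      case True
      then have "2 ^ m \<le> r + 1"
        using dyck_number_power_add_lower_bound e r m(2) by blast
      then show ?thesis using M[of m] r target by simp
    next
      \<comment> \<open>Here \<open>e\<close> may have more than \<open>n + 1\<close> digits, but
        \<open>r \<ge> 2 ^ n \<ge> 2 ^ m\<close> already exceeds \<open>mersenne m\<close>.\<close>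
      case False
      moreover have "(2::nat) ^ m \<le> 2 ^ n" using m(3) by simp
      ultimately show ?thesis using M[of m] r target by linarith
    qed
  qed
qed

end
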